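(* Let $I\subseteq\mathbb{R}$ be a proper interval and let $F\colon I^2\to I$ be a reflexive, partially strictly increasing, symmetric and bisymmetric mapping. Then $F$ is continuous (as a function of two variables on $I^2$).
   Context: A proper interval is an interval of $\mathbb{R}$ with at least two elements (it may be open, closed, half-open, bounded or unbounded). A map $F\colon I^2\to I$ is reflexive if $F(x,x)=x$ for every $x\in I$. It is partially strictly increasing if for every fixed $x_0,y_0\in I$ the functions $x\mapsto F(x,y_0)$ and $y\mapsto F(x_0,y)$ are strictly increasing on $I$. It is symmetric if $F(x,y)=F(y,x)$ for every $x,y\in I$. It is bisymmetric if $F\big(F(x,y),F(u,v)\big)=F\big(F(x,u),F(y,v)\big)$ for every $x,y,u,v\in I$. *)

theory Defs
  imports "HOL-Analysis.Analysis"
begin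

definition proper_interval :: "real set \<Rightarrow> bool" where
  "proper_interval I \<longleftrightarrow> is_interval I \<and> (\<exists>a\<in>I. \<exists>b\<in>I. a \<noteq> b)"

text \<open>A map from \<open>I \<times> I\<close> to \<open>I\<close> is represented by a total curried function
  together with closure of \<open>I\<close> under it; values outside \<open>I\<close> play no role below.\<close>

definition maps_into_on :: "real set \<Rightarrow> (real \<Rightarrow> real \<Rightarrow> real) \<Rightarrow> bool" where
  "maps_into_on I F \<longleftrightarrow> (\<forall>x\<in>I. \<forall>y\<in>I. F x y \<in> I)"

definition reflexive_on :: "real set \<Rightarrow> (real \<Rightarrow> real \<Rightarrow> real) \<Rightarrow> bool" where
  "reflexive_on I F \<longleftrightarrow> (\<forall>x\<in>I. F x x = x)"

definition partially_strictly_increasing_on ::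
    "real set \<Rightarrow> (real \<Rightarrow> real \<Rightarrow> real) \<Rightarrow> bool" where
  "partially_strictly_increasing_on I F \<longleftrightarrow>
     (\<forall>x0\<in>I. \<forall>y0\<in>I. strict_mono_on I (\<lambda>x. F x y0) \<and> strict_mono_on I (\<lambda>y. F x0 y))"

definition symmetric_on :: "real set \<Rightarrow> (real \<Rightarrow> real \<Rightarrow> real) \<Rightarrow> bool" where
  "symmetric_on I F \<longleftrightarrow> (\<forall>x\<in>I. \<forall>y\<in>I. F x y = F y x)"

definition bisymmetric_on :: "real set \<Rightarrow> (real \<Rightarrow> real \<Rightarrow> real) \<Rightarrow> bool" where
  "bisymmetric_on I F \<longleftrightarrow>
     (\<forall>x\<in>I. \<forall>y\<in>I. \<forall>u\<in>I. \<forall>v\<in>I. F (F x y) (F u v) = F (F x u) (F y v))"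

end

theory Submission
  imports Defs
begin

text \<open>Fix \<open>a < b\<close> in \<open>I\<close>. Bisymmetry makes iterated means of \<open>a\<close> and \<open>b\<close> consistent, so they form a
  strictly increasing family indexed by the dyadic rationals of \<open>[0, 1]\<close>; its generalised inverse
  \<open>G\<close> is nondecreasing, maps \<open>[a, b]\<close> onto \<open>[0, 1]\<close> and satisfies \<open>G (F x y) = (G x + G y) / 2\<close>.
  If \<open>G\<close> took the same value at \<open>x < y\<close>, the intervals \<open>(F x z, F y z)\<close> for representatives \<open>z\<close>
  of the levels of \<open>G\<close> would be uncountably many pairwise disjoint nonempty open intervals. Hence
  \<open>G\<close> is a homeomorphism, and \<open>F x y = G\<^sup>-\<^sup>1 ((G x + G y) / 2)\<close> is continuous on \<open>[a, b]\<^sup>2\<close>.\<close>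

section \<open>Monotone real functions, dyadic estimates and disjoint intervals\<close>

text \<open>A discontinuity of a monotone function is a jump, and a jump leaves a gap in the image.
  It serves both for \<open>G\<close> and for its inverse.\<close>

lemma continuous_on_mono_on_is_interval_image:
  fixes f :: "real \<Rightarrow> real"
  assumes mono: "mono_on A f" and img: "is_interval (f ` A)"
  shows "continuous_on A f"
  unfolding continuous_on_def
proof (intro ballI order_tendstoI)
  fix x e assume x: "x \<in> A" and e: "e < f x"
  show "\<forall>\<^sub>F y in at x within A. e < f y"
  proof (cases "\<exists>y\<in>A. f y \<le> e")
    case True
    then obtain y where y: "y \<in> A" "f y \<le> e" by auto
    obtain m where m: "e < m" "m < f x" using dense[OF e] by auto
    have "m \<in> f ` A"
      using mem_is_interval_1_I[OF img, of "f y" "f x" m] x y m by auto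
    then obtain z where z: "z \<in> A" "m = f z" by auto
    have "z < x" using mono x z m by (metis mono_onD not_le)
    then have "\<forall>\<^sub>F y in at x within A. z < y"
      by (rule order_tendstoD(1)[OF tendsto_ident_at])
    moreover have "\<forall>\<^sub>F y in at x within A. y \<in> A"
      by (simp add: eventually_at_filter)
    ultimately show ?thesis
    proof eventually_elim
      case (elim y)
      then show ?case using mono_onD[OF mono z(1), of y] z m by simp
    qed
  next
    case False
    then show ?thesis by (auto simp: eventually_at_filter not_le)
  qed
next
  fix x e assume x: "x \<in> A" and e: "f x < e"
  show "\<forall>\<^sub>F y in at x within A. f y < e"
  proof (cases "\<exists>y\<in>A. e \<le> f y")
    case True
    then obtain y where y: "y \<in> A" "e \<le> f y" by auto
    obtain m where m: "f x < m" "m < e" using dense[OF e] by auto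
    have "m \<in> f ` A"
      using mem_is_interval_1_I[OF img, of "f x" "f y" m] x y m by auto
    then obtain z where z: "z \<in> A" "m = f z" by auto
    have "x < z" using mono x z m by (metis mono_onD not_le)
    then have "\<forall>\<^sub>F y in at x within A. y < z"
      by (rule order_tendstoD(2)[OF tendsto_ident_at])
    moreover have "\<forall>\<^sub>F y in at x within A. y \<in> A"
      by (simp add: eventually_at_filter)
    ultimately show ?thesis
    proof eventually_elim
      case (elim y)
      then show ?case using mono_onD[OF mono _ z(1), of y] z m by simp
    qed
  next
    case False
    then show ?thesis by (auto simp: eventually_at_filter not_le)
  qed
qed

lemma eq_if_abs_diff_le_dyadic:
  fixes x y :: real
  assumes "\<And>n. \<bar>x - y\<bar> \<le> c / 2 ^ n"
  shows "x = y"
proof -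
  have "(\<lambda>n. c * (1 / 2) ^ n) \<longlonglongrightarrow> c * 0"
    by (intro tendsto_mult tendsto_const LIMSEQ_realpow_zero) auto
  then have "\<bar>x - y\<bar> \<le> 0"
    using assms by (intro LIMSEQ_le_const[where X = "\<lambda>n. c * (1 / 2) ^ n"]) (auto simp: power_one_over)
  then show ?thesis by simp
qed

text \<open>Choosing a rational in each interval is injective by disjointness.\<close>

lemma countable_family_of_disjoint_intervals:
  fixes l u :: "'i \<Rightarrow> real"
  assumes nonempty: "\<And>s. s \<in> S \<Longrightarrow> l s < u s"
    and disjoint: "disjoint_family_on (\<lambda>s. {l s<..<u s}) S"
  shows "countable S"
proof -
  have "\<exists>q. l s < of_rat q \<and> of_rat q < u s" if "s \<in> S" for s
    using of_rat_dense[OF nonempty[OF that]] by auto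
  then obtain q where q: "\<And>s. s \<in> S \<Longrightarrow> of_rat (q s) \<in> {l s<..<u s}"
    by (metis greaterThanLessThan_iff)
  have "inj_on q S"
    using q disjoint unfolding inj_on_def disjoint_family_on_def by (metis disjoint_iff)
  then show ?thesis by (meson countableI_type countable_image_inj_on)
qed

section \<open>Dyadic means of two points\<close>

text \<open>By reflexivity, an even index \<open>2 * k\<close> at level \<open>Suc n\<close> repeats the point of index \<open>k\<close> at
  level \<open>n\<close>; so \<open>dyadic_mean F a b n k\<close> is the point with parameter \<open>k / 2 ^ n\<close>. Indices above
  \<open>2 ^ n\<close> are junk.\<close>

fun dyadic_mean :: "(real \<Rightarrow> real \<Rightarrow> real) \<Rightarrow> real \<Rightarrow> real \<Rightarrow> nat \<Rightarrow> nat \<Rightarrow> real" where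
  "dyadic_mean F a b 0 k = (if k = 0 then a else b)"
| "dyadic_mean F a b (Suc n) k =
     F (dyadic_mean F a b n (k div 2)) (dyadic_mean F a b n (Suc k div 2))"

locale bisymmetric_mean =
  fixes F :: "real \<Rightarrow> real \<Rightarrow> real" and a b :: real
  assumes less: "a < b"
    and refl: "reflexive_on {a..b} F"
    and incr: "partially_strictly_increasing_on {a..b} F"
    and symm: "symmetric_on {a..b} F"
    and bisymm: "bisymmetric_on {a..b} F"
begin

lemma idem: "x \<in> {a..b} \<Longrightarrow> F x x = x"
  using refl by (simp add: reflexive_on_def)

lemma commute: "x \<in> {a..b} \<Longrightarrow> y \<in> {a..b} \<Longrightarrow> F x y = F y x"
  using symm by (simp add: symmetric_on_def)

lemma interchange:
  "\<lbrakk>x \<in> {a..b}; y \<in> {a..b}; u \<in> {a..b}; v \<in> {a..b}\<rbrakk> \<Longrightarrow> F (F x y) (F u v) = F (F x u) (F y v)"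
  using bisymm unfolding bisymmetric_on_def by blast

lemma strict_left: "\<lbrakk>x \<in> {a..b}; x' \<in> {a..b}; y \<in> {a..b}; x < x'\<rbrakk> \<Longrightarrow> F x y < F x' y"
  using incr unfolding partially_strictly_increasing_on_def by (blast dest: strict_mono_onD)

lemma mono_both:
  assumes "x \<in> {a..b}" "x' \<in> {a..b}" "y \<in> {a..b}" "y' \<in> {a..b}" "x \<le> x'" "y \<le> y'"
  shows "F x y \<le> F x' y'"
proof -
  have "F x y \<le> F x' y" using assms strict_left[of x x' y] by (cases "x = x'") auto
  also have "\<dots> = F y x'" using assms by (intro commute)
  also have "\<dots> \<le> F y' x'" using assms strict_left[of y y' x'] by (cases "y = y'") auto
  also have "\<dots> = F x' y'" using assms by (intro commute)
  finally show ?thesis .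
qed

text \<open>Monotonicity squeezes \<open>F x y\<close> between \<open>F a a = a\<close> and
  \<open>F b b = b\<close>.\<close>

lemma closed:
  assumes "x \<in> {a..b}" "y \<in> {a..b}"
  shows "F x y \<in> {a..b}"
  using mono_both[of a x a y] mono_both[of x b y b] idem[of a] idem[of b] assms less by simp

abbreviation f :: "nat \<Rightarrow> nat \<Rightarrow> real" where "f \<equiv> dyadic_mean F a b"

lemma f_closed: "f n k \<in> {a..b}"
proof (induction n arbitrary: k)
  case 0
  then show ?case using less by simp
next
  case (Suc n)
  then show ?case by (simp only: dyadic_mean.simps closed)
qed

lemma f_0: "f n 0 = a"
  by (induction n) (use less in \<open>auto simp: idem\<close>)

lemma f_double: "f (Suc n) (2 * k) = f n k"
  using idem[OF f_closed] by simp

text \<open>Passing to a finer level keeps the point, so points of different levels can be compared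
  at a common one.\<close>

lemma f_scale: "f (n + m) (2 ^ m * k) = f n k"
proof (induction m)
  case 0
  then show ?case by simp
next
  case (Suc m)
  then show ?case using f_double[of "n + m" "2 ^ m * k"] by (simp only: add_Suc_right power_Suc mult.assoc)
qed

lemma f_top: "f n (2 ^ n) = b"
  using f_scale[of 0 n 1] by simp

text \<open>Of two consecutive points at level \<open>Suc n\<close>, one is a point of level
  \<open>n\<close> and the other is its mean with a neighbour; a mean of distinct points lies
  strictly between them.\<close>

lemma f_Suc_less: "k < 2 ^ n \<Longrightarrow> f n k < f n (Suc k)"
proof (induction n arbitrary: k)
  case 0
  then show ?case using less by simp
next
  case (Suc n)
  define i where "i = k div 2"
  have "i < 2 ^ n" using Suc.prems by (auto simp: i_def)
  then have lt: "f n i < f n (Suc i)" by (rule Suc.IH)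
  have left: "F (f n i) (f n (Suc i)) < F (f n (Suc i)) (f n (Suc i))"
    using lt by (intro strict_left f_closed)
  have right: "F (f n i) (f n i) < F (f n i) (f n (Suc i))"
    using strict_left[OF f_closed f_closed f_closed lt] by (simp only: commute[OF f_closed f_closed])
  show ?case
  proof (cases "even k")
    case True
    then have "k = 2 * i" by (simp add: i_def)
    then show ?thesis using right by simp
  next
    case False
    then have "k = Suc (2 * i)" by (simp add: i_def)
    then show ?thesis using left by simp
  qed
qed

lemma f_less: "k < l \<Longrightarrow> l \<le> 2 ^ n \<Longrightarrow> f n k < f n l"
proof (induction l)
  case 0
  then show ?case by simp
next
  case (Suc l)
  have "f n l < f n (Suc l)" using Suc.prems by (intro f_Suc_less) simp
  moreover have "f n k \<le> f n l" using Suc by (cases "k = l") auto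
  ultimately show ?case by simp
qed

text \<open>This is the midpoint law on dyadic parameters, the source of the equation for
  \<open>G\<close>. Bisymmetry carries it from one level to the next.\<close>

lemma F_f: "k \<le> 2 ^ n \<Longrightarrow> l \<le> 2 ^ n \<Longrightarrow> F (f n k) (f n l) = f (Suc n) (k + l)"
proof (induction n arbitrary: k l)
  case 0
  then have "k = 0 \<or> k = 1" "l = 0 \<or> l = 1" by auto
  then show ?case using less by (auto simp: commute)
next
  case (Suc n)
  define k0 k1 l0 l1 where "k0 = k div 2" "k1 = Suc k div 2" "l0 = l div 2" "l1 = Suc l div 2"
  note defs = this
  have le: "k0 \<le> 2 ^ n" "k1 \<le> 2 ^ n" "l0 \<le> 2 ^ n" "l1 \<le> 2 ^ n"
    using Suc.prems by (auto simp: defs)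
  \<comment> \<open>The second mean is reversed so that the interchange pairs \<open>k0\<close> with
    \<open>l1\<close> and \<open>k1\<close> with \<open>l0\<close>. For odd \<open>k\<close> and
    \<open>l\<close>, the sums \<open>k0 + l0\<close> and \<open>k1 + l1\<close> would not be the
    halves of \<open>k + l\<close>.\<close>
  have "F (f (Suc n) k) (f (Suc n) l) = F (F (f n k0) (f n k1)) (F (f n l1) (f n l0))"
    using commute[OF f_closed f_closed] by (simp add: defs)
  also have "\<dots> = F (F (f n k0) (f n l1)) (F (f n k1) (f n l0))"
    by (intro interchange f_closed)
  also have "\<dots> = F (f (Suc n) (k0 + l1)) (f (Suc n) (k1 + l0))"
    by (simp only: Suc.IH le)
  also have "\<dots> = F (f (Suc n) ((k + l) div 2)) (f (Suc n) (Suc (k + l) div 2))"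
  proof -
    \<comment> \<open>The halves come out swapped when \<open>k\<close> is even and \<open>l\<close>
      odd; symmetry of \<open>F\<close> absorbs this.\<close>
    have "k0 + l1 = (k + l) div 2 \<and> k1 + l0 = Suc (k + l) div 2 \<or>
          k0 + l1 = Suc (k + l) div 2 \<and> k1 + l0 = (k + l) div 2"
      unfolding defs by (cases "even k"; cases "even l") (auto elim!: evenE oddE)
    then show ?thesis using commute[OF f_closed f_closed] by metis
  qed
  also have "\<dots> = f (Suc (Suc n)) (k + l)" by (simp only: dyadic_mean.simps)
  finally show ?case .
qed

section \<open>The generalised inverse of the dyadic means\<close>

text \<open>At the common level \<open>n + m\<close> the points are strictly increasing in the
  index, so their order determines that of the parameters.\<close>

lemma f_le_imp_ratio_le:
  assumes "f m j \<le> f n k" "j \<le> 2 ^ m" "k \<le> 2 ^ n"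
  shows "real j / 2 ^ m \<le> real k / 2 ^ n"
proof -
  have "2 ^ n * j \<le> 2 ^ m * k"
  proof (rule ccontr)
    assume "\<not> ?thesis"
    moreover have "2 ^ n * j \<le> 2 ^ (n + m)" using assms(2) by (simp add: power_add)
    ultimately have "f (n + m) (2 ^ m * k) < f (n + m) (2 ^ n * j)"
      by (intro f_less) auto
    then show False
      using assms(1) f_scale[of n m k] f_scale[of m n j] by (simp add: add.commute)
  qed
  then have "real (2 ^ n * j) \<le> real (2 ^ m * k)" by (simp only: of_nat_le_iff)
  then show ?thesis by (simp add: field_simps)
qed

definition G :: "real \<Rightarrow> real" where
  "G x = Sup {real k / 2 ^ n | n k. k \<le> 2 ^ n \<and> f n k \<le> x}"

lemma G_ge:
  assumes "f n k \<le> x" "k \<le> 2 ^ n"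
  shows "real k / 2 ^ n \<le> G x"
  unfolding G_def
proof (rule cSup_upper)
  have "real k / 2 ^ n \<le> 1" if "k \<le> 2 ^ n" for n k
    using of_nat_mono[OF that, where ?'a = real] by simp
  then show "bdd_above {real k / 2 ^ n | n k. k \<le> 2 ^ n \<and> f n k \<le> x}"
    by (intro bdd_aboveI[of _ 1]) auto
qed (use assms in auto)

lemma G_le:
  assumes "x \<in> {a..b}" "x \<le> f n k" "k \<le> 2 ^ n"
  shows "G x \<le> real k / 2 ^ n"
  unfolding G_def
proof (rule cSup_least)
  have "real 0 / 2 ^ 0 \<in> {real k / 2 ^ n | n k. k \<le> 2 ^ n \<and> f n k \<le> x}"
    using f_0[of 0] assms(1) by fastforce
  then show "{real k / 2 ^ n | n k. k \<le> 2 ^ n \<and> f n k \<le> x} \<noteq> {}" by blast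
next
  fix t assume "t \<in> {real k / 2 ^ n | n k. k \<le> 2 ^ n \<and> f n k \<le> x}"
  then show "t \<le> real k / 2 ^ n" using assms by (auto intro: f_le_imp_ratio_le)
qed

lemma bracket:
  assumes "x \<in> {a..b}"
  obtains k where "k < 2 ^ n" "f n k \<le> x" "x \<le> f n (Suc k)"
proof (cases "x = b")
  case True
  have "Suc (2 ^ n - 1) = (2 ^ n :: nat)" by simp
  then show ?thesis
    using that[of "2 ^ n - 1"] f_top[of n] f_closed[of n "2 ^ n - 1"] True by simp
next
  case False
  then have "\<exists>j\<le>2 ^ n. x < f n j" using f_top[of n] assms by auto
  \<comment> \<open>The lower end of the bracket is the predecessor of the first index whose point
    exceeds \<open>x\<close>. For \<open>x = b\<close> there is no such index, hence the separate
    case.\<close>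
  define j where "j = (LEAST j. x < f n j)"
  have j: "x < f n j" "j \<le> 2 ^ n"
    using \<open>\<exists>j\<le>2 ^ n. x < f n j\<close> unfolding j_def
    by (auto intro: LeastI Least_le le_trans)
  have "j \<noteq> 0" using j f_0[of n] assms by (intro notI) auto
  then obtain k where k: "j = Suc k" by (cases j) auto
  have "\<not> x < f n k" using not_less_Least[of k "\<lambda>j. x < f n j"] k j_def by simp
  then show ?thesis using that[of k] j k by auto
qed

lemma G_bounds: "x \<in> {a..b} \<Longrightarrow> G x \<in> {0..1}"
  using G_ge[of 0 0 x] G_le[of x 0 1] by simp

lemma G_mono:
  assumes "x \<in> {a..b}" "y \<in> {a..b}" "x \<le> y"
  shows "G x \<le> G y"
proof -
  have "real 0 / 2 ^ 0 \<in> {real k / 2 ^ n | n k. k \<le> 2 ^ n \<and> f n k \<le> x}"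
    using f_0[of 0] assms(1) by fastforce
  then have "{real k / 2 ^ n | n k. k \<le> 2 ^ n \<and> f n k \<le> x} \<noteq> {}" by blast
  then show ?thesis
    unfolding G_def[of x] by (rule cSup_least) (use assms(3) in \<open>force intro: G_ge\<close>)
qed

text \<open>Bracketing \<open>x\<close> and \<open>y\<close> at level \<open>n\<close> traps
  \<open>F x y\<close> between the points of index \<open>k + l\<close> and \<open>k + l + 2\<close>
  at level \<open>Suc n\<close>. Both sides of the equation then lie in one interval of length
  \<open>1 / 2 ^ n\<close>.\<close>

lemma G_F:
  assumes "x \<in> {a..b}" "y \<in> {a..b}"
  shows "G (F x y) = (G x + G y) / 2"
proof (rule eq_if_abs_diff_le_dyadic)
  fix n
  obtain k where k: "k < 2 ^ n" "f n k \<le> x" "x \<le> f n (Suc k)" using bracket assms(1) .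
  obtain l where l: "l < 2 ^ n" "f n l \<le> y" "y \<le> f n (Suc l)" using bracket assms(2) .
  have "f (Suc n) (k + l) = F (f n k) (f n l)" using k l by (simp only: F_f less_imp_le)
  also have "\<dots> \<le> F x y" using k l assms f_closed by (intro mono_both)
  finally have lo: "real (k + l) / 2 ^ Suc n \<le> G (F x y)" using k l by (intro G_ge) auto
  have "F x y \<le> F (f n (Suc k)) (f n (Suc l))" using k l assms f_closed by (intro mono_both)
  also have "\<dots> = f (Suc n) (Suc k + Suc l)" using k l by (simp only: F_f Suc_leI)
  finally have hi: "G (F x y) \<le> real (Suc k + Suc l) / 2 ^ Suc n"
    using k l by (intro G_le closed assms) auto
  have "real k / 2 ^ n \<le> G x" "G x \<le> real (Suc k) / 2 ^ n"
    using k assms by (auto intro!: G_ge G_le simp del: of_nat_Suc)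
  moreover have "real l / 2 ^ n \<le> G y" "G y \<le> real (Suc l) / 2 ^ n"
    using l assms by (auto intro!: G_ge G_le simp del: of_nat_Suc)
  ultimately show "\<bar>G (F x y) - (G x + G y) / 2\<bar> \<le> 1 / 2 ^ n"
    using lo hi by (simp add: abs_le_iff add_divide_distrib)
qed

lemma G_surj:
  assumes "s \<in> {0..1}"
  shows "\<exists>z\<in>{a..b}. G z = s"
\<comment> \<open>For \<open>s < 1\<close> the index \<open>k\<close> below satisfies
  \<open>k < 2 ^ n\<close>, so \<open>Suc k\<close> is still a valid index.\<close>
proof (cases "s = 1")
  case True
  have "G b = 1"
    using G_ge[of 0 1 b] G_bounds[of b] less by simp
  then show ?thesis using True less by (intro bexI[of _ b]) auto
next
  case False
  \<comment> \<open>The preimage of \<open>s\<close> is the supremum of the dyadic points with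
    parameter at most \<open>s\<close>.\<close>
  define Z where "Z = {f n k | n k. k \<le> 2 ^ n \<and> real k / 2 ^ n \<le> s}"
  have "f 0 0 \<in> Z" unfolding Z_def using assms by fastforce
  then have ne: "Z \<noteq> {}" by blast
  have sub: "Z \<subseteq> {a..b}" unfolding Z_def using f_closed by blast
  then have bdd: "bdd_above Z" by (meson bdd_above_Icc bdd_above_mono)
  have z: "Sup Z \<in> {a..b}"
    using closed_subset_contains_Sup[OF closed_atLeastAtMost sub ne bdd] .
  have "G (Sup Z) = s"
  proof (rule eq_if_abs_diff_le_dyadic)
    fix n
    define k where "k = nat \<lfloor>s * 2 ^ n\<rfloor>"
    have k: "real k \<le> s * 2 ^ n" "s * 2 ^ n < real (Suc k)"
      using assms by (auto simp: k_def) linarith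
    have "s * 2 ^ n < 1 * (2::real) ^ n" using assms False by (intro mult_strict_right_mono) auto
    then have "real k < real (2 ^ n)" using k by (simp only: of_nat_power of_nat_numeral mult_1)
    then have k2: "k < 2 ^ n" by (simp only: of_nat_less_iff)
    have k3: "real k / 2 ^ n \<le> s" "s < real (Suc k) / 2 ^ n" using k by (auto simp: field_simps)
    have "f n k \<in> Z" unfolding Z_def using k2 k3 less_imp_le by blast
    then have "real k / 2 ^ n \<le> G (Sup Z)" using bdd k2 by (intro G_ge cSup_upper) auto
    moreover have "Sup Z \<le> f n (Suc k)"
    proof (rule cSup_least[OF ne])
      fix t assume "t \<in> Z"
      then obtain m j where mj: "t = f m j" "j \<le> 2 ^ m" "real j / 2 ^ m \<le> s"
        unfolding Z_def by auto
      show "t \<le> f n (Suc k)"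
      proof (rule ccontr)
        assume "\<not> ?thesis"
        then have "real (Suc k) / 2 ^ n \<le> real j / 2 ^ m"
          using mj k2 by (intro f_le_imp_ratio_le) auto
        then show False using mj k3 by linarith
      qed
    qed
    then have "G (Sup Z) \<le> real (Suc k) / 2 ^ n" using z k2 by (intro G_le) auto
    ultimately show "\<bar>G (Sup Z) - s\<bar> \<le> 1 / 2 ^ n"
      using k3 by (simp add: abs_le_iff add_divide_distrib)
  qed
  then show ?thesis using z by blast
qed

section \<open>Injectivity of \<open>G\<close> and continuity on a compact square\<close>

lemma G_strict:
  assumes x: "x \<in> {a..b}" and y: "y \<in> {a..b}" and xy: "x < y"
  shows "G x < G y"
proof (rule ccontr)
  assume "\<not> ?thesis"
  then have eq: "G x = G y" using G_mono[OF x y] xy by simp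
  obtain z where z: "\<And>s. s \<in> {0..1} \<Longrightarrow> z s \<in> {a..b} \<and> G (z s) = s"
    using G_surj by metis
  \<comment> \<open>If this failed, applying \<open>G\<close> would give
    \<open>(G x + t) / 2 \<le> (G y + s) / 2\<close>, impossible for \<open>G x = G y\<close> and
    \<open>s < t\<close>.\<close>
  have sep: "F y (z s) \<le> F x (z t)" if "s \<in> {0..1}" "t \<in> {0..1}" "s < t" for s t
  proof (rule ccontr)
    assume "\<not> ?thesis"
    then have "G (F x (z t)) \<le> G (F y (z s))" using x y z that by (intro G_mono closed) auto
    then show False using x y z that eq by (simp add: G_F)
  qed
  have "disjoint_family_on (\<lambda>s. {F x (z s)<..<F y (z s)}) {0..1}"
    unfolding disjoint_family_on_def
  proof (intro ballI impI)
    fix s t :: real assume "s \<in> {0..1}" "t \<in> {0..1}" "s \<noteq> t"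
    then show "{F x (z s)<..<F y (z s)} \<inter> {F x (z t)<..<F y (z t)} = {}"
      using sep[of s t] sep[of t s] by (cases s t rule: linorder_cases) auto
  qed
  then have "countable {0..1::real}"
    by (rule countable_family_of_disjoint_intervals[rotated]) (use x y xy z in \<open>blast intro: strict_left\<close>)
  then show False using uncountable_closed_interval[of 0 1] by simp
qed

lemma continuous_on_square: "continuous_on ({a..b} \<times> {a..b}) (\<lambda>(x, y). F x y)"
proof -
  define g where "g = inv_into {a..b} G"
  have inj: "inj_on G {a..b}"
    by (rule linorder_inj_onI) (use G_strict in fastforce)+
  have img: "G ` {a..b} = {0..1}" using G_bounds G_surj by force
  have gG: "g (G x) = x" if "x \<in> {a..b}" for x
    unfolding g_def using inj that by (rule inv_into_f_f)
  have contG: "continuous_on {a..b} G"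
    by (rule continuous_on_mono_on_is_interval_image)
      (auto simp: img is_interval_cc intro!: mono_onI G_mono)
  have "mono_on {0..1} g"
  proof (rule mono_onI)
    fix s t :: real assume st: "s \<in> {0..1}" "t \<in> {0..1}" "s \<le> t"
    then obtain x y where xy: "x \<in> {a..b}" "y \<in> {a..b}" "G x = s" "G y = t"
      using G_surj by metis
    then have "x \<le> y" using G_strict[of y x] st by (meson not_le)
    then show "g s \<le> g t" using xy gG[of x] gG[of y] by simp
  qed
  \<comment> \<open>The inverse is monotone with an interval as image, so its continuity follows in
    the same way as that of \<open>G\<close>.\<close>
  moreover have "g ` {0..1} = {a..b}"
    unfolding img[symmetric] image_image using gG by simp
  ultimately have contg: "continuous_on {0..1} g"
    by (intro continuous_on_mono_on_is_interval_image) (auto simp: is_interval_cc)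
  have "continuous_on ({a..b} \<times> {a..b}) (\<lambda>p. g ((G (fst p) + G (snd p)) / 2))"
  proof (rule continuous_on_compose2[OF contg])
    show "continuous_on ({a..b} \<times> {a..b}) (\<lambda>p. (G (fst p) + G (snd p)) / 2)"
      by (intro continuous_intros continuous_on_compose2[OF contG]) auto
    show "(\<lambda>p. (G (fst p) + G (snd p)) / 2) ` ({a..b} \<times> {a..b}) \<subseteq> {0..1}"
    proof (clarsimp simp del: atLeastAtMost_iff)
      fix x y assume "x \<in> {a..b}" "y \<in> {a..b}"
      then show "(G x + G y) / 2 \<in> {0..1}" using G_bounds[of x] G_bounds[of y] by simp
    qed
  qed
  then show ?thesis
    by (rule continuous_on_eq) (auto simp del: atLeastAtMost_iff simp: gG closed simp flip: G_F)
qed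

end

section \<open>From compact squares to the whole interval\<close>

theorem theorem9:
  fixes I :: "real set" and F :: "real \<Rightarrow> real \<Rightarrow> real"
  assumes "proper_interval I"
    and "maps_into_on I F"
    and "reflexive_on I F"
    and "partially_strictly_increasing_on I F"
    and "symmetric_on I F"
    and "bisymmetric_on I F"
  shows "continuous_on (I \<times> I) (\<lambda>(x, y). F x y)"
proof -
  have square: "continuous_on ({a..b} \<times> {a..b}) (\<lambda>(x, y). F x y)"
    if "a \<in> I" "b \<in> I" for a b
  proof (cases "a < b")
    case True
    have sub: "{a..b} \<subseteq> I"
      using assms(1) that mem_is_interval_1_I[of I a b] by (auto simp: proper_interval_def)
    interpret bisymmetric_mean F a b
    proof
      show "partially_strictly_increasing_on {a..b} F"
        using assms(4) sub unfolding partially_strictly_increasing_on_def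
        by (meson monotone_on_subset subset_iff)
    qed (use assms sub True in \<open>auto simp: reflexive_on_def symmetric_on_def bisymmetric_on_def subset_iff\<close>)
    show ?thesis by (rule continuous_on_square)
  next
    \<comment> \<open>The degenerate case \<open>a = b\<close> does occur below, when all
      coordinates of the sequence and its limit coincide.\<close>
    case False
    then have "{a..b} \<subseteq> {a}" by auto
    then have "{a..b} \<times> {a..b} \<subseteq> {(a, a)}" by auto
    then show ?thesis by (rule continuous_on_subset[rotated]) simp
  qed
  show ?thesis
    unfolding continuous_on_sequentially
  proof (intro allI ballI impI, elim conjE)
    fix X :: "nat \<Rightarrow> real \<times> real" and p
    assume p: "p \<in> I \<times> I" and X: "\<forall>n. X n \<in> I \<times> I" and lim: "X \<longlonglongrightarrow> p"
    \<comment> \<open>A convergent sequence together with its limit is compact, so its coordinates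
      attain a minimum \<open>a\<close> and a maximum \<open>b\<close>, both in \<open>I\<close>.
      The sequence thus stays in one square \<open>{a..b} \<times> {a..b}\<close>, even when
      \<open>p\<close> lies on the boundary of \<open>I \<times> I\<close>.\<close>
    define K where "K = insert p (range X)"
    define L where "L = fst ` K \<union> snd ` K"
    have "compact K" unfolding K_def using lim by (rule compact_sequence_with_limit)
    then have "compact L"
      unfolding L_def by (intro compact_Un compact_continuous_image continuous_intros)
    moreover have "L \<noteq> {}" by (simp add: L_def K_def)
    ultimately obtain a b where ab: "a \<in> L" "b \<in> L" "\<And>t. t \<in> L \<Longrightarrow> a \<le> t \<and> t \<le> b"
      by (metis compact_attains_inf compact_attains_sup)
    have "L \<subseteq> I" using p X by (force simp: L_def K_def mem_Times_iff)
    then have "continuous_on ({a..b} \<times> {a..b}) (\<lambda>(x, y). F x y)" using ab by (intro square) auto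
    moreover have "q \<in> {a..b} \<times> {a..b}" if "q \<in> K" for q
      using that ab by (simp add: L_def mem_Times_iff)
    ultimately show "((\<lambda>(x, y). F x y) \<circ> X) \<longlonglongrightarrow> (case p of (x, y) \<Rightarrow> F x y)"
      using continuous_on_tendsto_compose[OF _ lim, of _ "\<lambda>(x, y). F x y"]
      by (simp add: K_def comp_def)
  qed
qed

end
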